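(* Let $b,d,e,y,u,w,q$ be nonzero complex numbers, $t_1,t_2>0$, let $r_1,r_2,s_1,s_2$ be nonnegative real numbers, and let $n\ge0$ be an integer. Put $C_0(t_1)=(1-bt_1)(1-dt_1)/t_1$ and $D_0(t_2)=(1-yt_2)(1-wt_2)/t_2$. Assume that no denominator below vanishes. Then $$C_0(t_1)\sum_{k=0}^{n-1}(1-et_1q^{2(r_2-r_1)(k-1)})(1-bdet_1q^{2(r_1+r_2)(k-1)+2})\,q^{2r_1(k-1)+1}$$ $$\times\frac{(bq,dq;q^{2r_1})_{k-1}(eq,bdet_1^2q;q^{2r_2})_{k-1}}{(det_1q,bet_1q;q^{2r_2})_k(bdt_1q,q/t_1;q^{2r_1})_k}\,\frac{(yq,wq;q^{2s_1})_k(uq,ywut_2^2q;q^{2s_2})_k}{(wut_2q,yut_2q;q^{2s_2})_k(ywt_2q,q/t_2;q^{2s_1})_k}$$ $$=\frac{(bq,dq;q^{2r_1})_{n-1}(eq,bdet_1^2q;q^{2r_2})_{n-1}}{(det_1q,bet_1q;q^{2r_2})_{n-1}(bdt_1q,q/t_1;q^{2r_1})_{n-1}}\,\frac{(yq,wq;q^{2s_1})_n(uq,ywut_2^2q;q^{2s_2})_n}{(wut_2q,yut_2q;q^{2s_2})_n(ywt_2q,q/t_2;q^{2s_1})_n}$$ $$-\frac{(q^{2r_2}-det_1q)(q^{2r_2}-bet_1q)(q^{2r_1}-bdt_1q)(q^{2r_1}-q/t_1)}{(q^{2r_1}-bq)(q^{2r_1}-dq)(q^{2r_2}-eq)(q^{2r_2}-bdet_1^2q)}$$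 $$-D_0(t_2)\sum_{k=0}^{n-1}(1-ut_2q^{2(s_2-s_1)k})(1-ywut_2q^{2(s_1+s_2)k+2})\,q^{2s_1k+1}$$ $$\times\frac{(yq,wq;q^{2s_1})_k(uq,ywut_2^2q;q^{2s_2})_k}{(wut_2q,yut_2q;q^{2s_2})_{k+1}(ywt_2q,q/t_2;q^{2s_1})_{k+1}}\,\frac{(bq,dq;q^{2r_1})_k(eq,bdet_1^2q;q^{2r_2})_k}{(det_1q,bet_1q;q^{2r_2})_k(bdt_1q,q/t_1;q^{2r_1})_k}.$$
   Context: For a nonzero base $q$ and an integer $m\ge 0$, $(a;q)_m=\prod_{j=0}^{m-1}(1-aq^j)$, $(a;q)_{-1}=1/(1-a/q)$, and $(a_1,\dots,a_l;q)_m=\prod_{i=1}^l(a_i;q)_m$. Real powers are $q^t=\exp(t\log q)$ for a fixed choice of $\log q$. Empty sums are $0$. (The paper calls this a $(2,2)$-type transformation with degree $2m$, $m=\max\{r_1,r_2,s_1,s_2\}$.) *)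

theory Defs
  imports Complex_Main
begin

text \<open>
  The power \<open>q\<^sup>t\<close> for real \<open>t\<close>, where \<open>L\<close> is the chosen logarithm of \<open>q\<close>
  (any \<open>L\<close> with \<open>exp L = q\<close>, not only the principal value, so \<open>powr\<close> is not used).
\<close>

definition qpow :: "complex \<Rightarrow> real \<Rightarrow> complex" where
  "qpow L t = exp (of_real t * L)"

text \<open>
  The \<open>q\<close>-shifted factorial \<open>(a;q)\<^sub>m\<close>. Below \<open>-1\<close> the usual extension is taken; only
  \<open>m \<ge> -1\<close> is needed. Because \<open>1 / 0 = 0\<close>, the condition \<open>qpoch a q (-1) \<noteq> 0\<close>
  says precisely that \<open>1 - a / q \<noteq> 0\<close>, i.e. that \<open>(a;q)\<^sub>-\<^sub>1\<close> is well defined.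
\<close>

definition qpoch :: "complex \<Rightarrow> complex \<Rightarrow> int \<Rightarrow> complex" where
  "qpoch a q m =
     (if m \<ge> 0 then (\<Prod>j<nat m. 1 - a * q ^ j)
      else 1 / (\<Prod>j=1..nat (- m). 1 - a / q ^ j))"

lemma qpoch_of_nat: "qpoch a q (int m) = (\<Prod>j<m. 1 - a * q ^ j)"
  by (simp add: qpoch_def)

lemma qpoch_minus_one: "qpoch a q (-1) = 1 / (1 - a / q)"
  by (simp add: qpoch_def)

definition qpochs :: "complex list \<Rightarrow> complex \<Rightarrow> int \<Rightarrow> complex" where
  "qpochs as q m = (\<Prod>a\<leftarrow>as. qpoch a q m)"

definition C0 :: "complex \<Rightarrow> complex \<Rightarrow> real \<Rightarrow> complex" where
  "C0 b d t = (1 - b * of_real t) * (1 - d * of_real t) / of_real t"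

definition D0 :: "complex \<Rightarrow> complex \<Rightarrow> real \<Rightarrow> complex" where
  "D0 y w t = (1 - y * of_real t) * (1 - w * of_real t) / of_real t"

end

theory Submission
  imports Defs
begin

text \<open>
  Let \<open>R\<^sub>k\<close> and \<open>S\<^sub>k\<close> be the quotients of \<open>q\<close>-shifted factorials in
  \<open>(b,d,e,t\<^sub>1)\<close> and \<open>(y,w,u,t\<^sub>2)\<close>. The difference of consecutive values of either one factors,
  because \<open>(1-bx)(1-dx)(1-ez)(1-bdet\<^sup>2z) - (1-detz)(1-betz)(1-bdtx)(1-x/t)\<close>
  equals \<open>(1-bt)(1-dt)/t \<cdot> (x-etz)(1-bdetxz)\<close>. Hence both sums are sums of products
  of one quotient with a difference of the other, and the identity is Abel summation;
  the boundary term is \<open>R\<^sub>-\<^sub>1 S\<^sub>0\<close>.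
\<close>

lemma qpow_add: "qpow L (s + t) = qpow L s * qpow L t"
  by (simp add: qpow_def distrib_right exp_add)

lemma qpow_nonzero [simp]: "qpow L t \<noteq> 0"
  by (simp add: qpow_def)

lemma qpow_powi: "qpow L t powi m = qpow L (t * of_int m)"
  by (simp add: qpow_def exp_power_int mult_ac)

lemma qpow_one: "qpow L 1 = exp L"
  by (simp add: qpow_def)

lemma qpochs_pair: "qpochs [a, c] q m = qpoch a q m * qpoch c q m"
  by (simp add: qpochs_def)

lemma qpochs_zero [simp]: "qpochs as q 0 = 1"
  by (induction as) (simp_all add: qpochs_def qpoch_def)

lemma int_ge_minus_one_cases:
  fixes m :: int
  assumes "m \<ge> -1"
  obtains "m = -1" | k where "m = int k"
  using assms by (metis int_one_le_iff_zero_less linorder_not_le nonneg_int_cases order_antisym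
      zle_add1_eq_le add.left_inverse)

text \<open>At \<open>m = -1\<close> the right-hand side is \<open>(1 - a/q) / (1 - a/q)\<close>,
  which in HOL is \<open>1\<close> only for \<open>a \<noteq> q\<close>; hence the third
  hypothesis.\<close>

lemma qpoch_succ:
  assumes "m \<ge> -1" and "q \<noteq> 0" and "m = -1 \<Longrightarrow> q \<noteq> a"
  shows "qpoch a q (m + 1) = qpoch a q m * (1 - a * q powi m)"
  using assms(1)
proof (cases rule: int_ge_minus_one_cases)
  case 1
  with assms show ?thesis
    by (simp add: qpoch_def field_simps)
next
  case (2 k)
  have "int k + 1 = int (Suc k)" by simp
  with 2 show ?thesis
    by (simp only: qpoch_of_nat power_int_of_nat prod.lessThan_Suc)
qed

text \<open>
  In a denominator no condition on \<open>(a;q)\<^sub>-\<^sub>1\<close> is needed: if \<open>a = q\<close>, then both sides are \<open>0\<close>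
  at \<open>m = -1\<close>.
\<close>

lemma inverse_qpoch:
  assumes "m \<ge> -1" and "q \<noteq> 0" and "qpoch a q (m + 1) \<noteq> 0"
  shows "inverse (qpoch a q m) = (1 - a * q powi m) / qpoch a q (m + 1)"
  using assms(1)
proof (cases rule: int_ge_minus_one_cases)
  case 1
  then show ?thesis
    by (simp add: qpoch_def divide_inverse)
next
  case (2 k)
  have "int k + 1 = int (Suc k)" by simp
  with 2 assms(3) show ?thesis
    by (simp only: qpoch_of_nat power_int_of_nat prod.lessThan_Suc) (simp add: field_simps)
qed

text \<open>Each factor on the right kills the left: if \<open>b*t = 1\<close>,
  \<open>d*t = 1\<close> or \<open>x = e*t*z\<close>, the two products consist of the same factors;
  if \<open>b*d*e*t*x*z = 1\<close>, they agree up to monomials with product \<open>1\<close>, for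
  instance \<open>1 - b*x = -b*x * (1 - d*e*t*z)\<close>.\<close>

lemma num_minus_den_factor:
  fixes b d e t x z :: complex
  assumes "t \<noteq> 0"
  shows "(1 - b*x) * (1 - d*x) * (1 - e*z) * (1 - b*d*e*t^2*z)
       - (1 - d*e*t*z) * (1 - b*e*t*z) * (1 - b*d*t*x) * (1 - x/t)
       = (1 - b*t) * (1 - d*t) / t * ((x - e*t*z) * (1 - b*d*e*t*x*z))"
proof -
  have "t * ((1 - b*x) * (1 - d*x) * (1 - e*z) * (1 - b*d*e*t^2*z))
       - (1 - d*e*t*z) * (1 - b*e*t*z) * (1 - b*d*t*x) * (t - x)
       = (1 - b*t) * (1 - d*t) * ((x - e*t*z) * (1 - b*d*e*t*x*z))"
    by algebra
  with assms show ?thesis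
    by (simp add: field_simps)
qed

text \<open>Numerator and denominator get separate names because the summands divide the numerator
  at one index by the denominator at the next.\<close>

definition poch_quotient_num :: "complex \<Rightarrow> complex \<Rightarrow> complex \<Rightarrow> complex \<Rightarrow> real \<Rightarrow> real \<Rightarrow> real \<Rightarrow> int \<Rightarrow> complex"
  where "poch_quotient_num L b d e t r1 r2 m =
    qpochs [b * exp L, d * exp L] (qpow L (2*r1)) m
    * qpochs [e * exp L, b*d*e*t^2 * exp L] (qpow L (2*r2)) m"

definition poch_quotient_den :: "complex \<Rightarrow> complex \<Rightarrow> complex \<Rightarrow> complex \<Rightarrow> real \<Rightarrow> real \<Rightarrow> real \<Rightarrow> int \<Rightarrow> complex"
  where "poch_quotient_den L b d e t r1 r2 m =
    qpochs [d*e*t * exp L, b*e*t * exp L] (qpow L (2*r2)) m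
    * qpochs [b*d*t * exp L, exp L / t] (qpow L (2*r1)) m"

definition poch_quotient :: "complex \<Rightarrow> complex \<Rightarrow> complex \<Rightarrow> complex \<Rightarrow> real \<Rightarrow> real \<Rightarrow> real \<Rightarrow> int \<Rightarrow> complex"
  where "poch_quotient L b d e t r1 r2 m = poch_quotient_num L b d e t r1 r2 m / poch_quotient_den L b d e t r1 r2 m"

text \<open>Over the denominator at \<open>m + 1\<close> both terms share the numerator at
  \<open>m\<close>; what remains is the difference in \<open>num_minus_den_factor\<close>.\<close>

lemma poch_quotient_diff:
  fixes t r1 r2 :: real and m :: int
  assumes "t \<noteq> 0" "m \<ge> -1"
    and den: "poch_quotient_den L b d e t r1 r2 (m + 1) \<noteq> 0"
    and num: "m = -1 \<Longrightarrow> qpow L (2*r1) \<noteq> b * exp L" "m = -1 \<Longrightarrow> qpow L (2*r1) \<noteq> d * exp L"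
      "m = -1 \<Longrightarrow> qpow L (2*r2) \<noteq> e * exp L" "m = -1 \<Longrightarrow> qpow L (2*r2) \<noteq> b*d*e*t^2 * exp L"
  shows "poch_quotient L b d e t r1 r2 (m + 1) - poch_quotient L b d e t r1 r2 m =
    C0 b d t * ((1 - e*t * qpow L (2*(r2 - r1) * of_int m))
      * (1 - b*d*e*t * qpow L (2*(r1 + r2) * of_int m + 2))
      * qpow L (2*r1 * of_int m + 1)
      * (poch_quotient_num L b d e t r1 r2 m / poch_quotient_den L b d e t r1 r2 (m + 1)))"
proof -
  define x where "x = exp L * qpow L (2*r1) powi m"
  define z where "z = exp L * qpow L (2*r2) powi m"
  let ?N = "poch_quotient_num L b d e t r1 r2" and ?D = "poch_quotient_den L b d e t r1 r2"
  have num_step: "?N (m + 1) = ?N m * ((1 - b*x) * (1 - d*x) * (1 - e*z) * (1 - b*d*e*t^2*z))"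
    unfolding poch_quotient_num_def qpochs_pair x_def z_def using assms(2) num
    by (simp add: qpoch_succ mult_ac)
  \<comment> \<open>Stated for the inverse so that it survives \<open>?D m = 0\<close>, which can
    occur at \<open>m = -1\<close>: a factor on the right is then \<open>0\<close> as well.\<close>
  have den_step: "inverse (?D m) =
      (1 - d*e*t*z) * (1 - b*e*t*z) * (1 - b*d*t*x) * (1 - x/t) / ?D (m + 1)"
    using den assms(2) unfolding poch_quotient_den_def qpochs_pair x_def z_def
    by (simp add: inverse_qpoch mult_ac)
  have x: "x = qpow L (2*r1 * of_int m + 1)"
    by (simp add: x_def qpow_powi qpow_add qpow_one)
  \<comment> \<open>In this form \<open>x\<close> can be pulled out of \<open>x - e*t*z\<close>,
    which yields the power of \<open>q\<close> in the summand.\<close>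
  have z: "z = qpow L (2*(r2 - r1) * of_int m) * x"
    by (simp add: x z_def qpow_powi algebra_simps flip: qpow_add qpow_one)
  have xz: "x * z = qpow L (2*(r1 + r2) * of_int m + 2)"
    unfolding z x by (simp add: algebra_simps flip: qpow_add)
  have common_factor: "N * A / D - N * (B / D) = N / D * (A - B)" for A B D N :: complex
    by (simp add: right_diff_distrib diff_divide_distrib)
  have "poch_quotient L b d e t r1 r2 (m + 1) - poch_quotient L b d e t r1 r2 m =
      ?N m / ?D (m + 1) * ((1 - b*x) * (1 - d*x) * (1 - e*z) * (1 - b*d*e*t^2*z)
       - (1 - d*e*t*z) * (1 - b*e*t*z) * (1 - b*d*t*x) * (1 - x/t))"
    unfolding poch_quotient_def num_step divide_inverse[of "?N m" "?D m"] den_step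
    by (rule common_factor)
  also have "\<dots> = ?N m / ?D (m + 1) * (C0 b d t * ((x - e*t*z) * (1 - b*d*e*t*(x*z))))"
    using num_minus_den_factor[of "of_real t" b x d e z] assms(1)
    by (simp add: C0_def mult.assoc)
  also have "x - e*t*z = (1 - e*t * qpow L (2*(r2 - r1) * of_int m)) * x"
    by (simp add: z algebra_simps)
  finally show ?thesis
    by (simp only: xz) (simp only: x mult_ac)
qed

lemma poch_quotient_0 [simp]: "poch_quotient L b d e t r1 r2 0 = 1"
  by (simp add: poch_quotient_def poch_quotient_num_def poch_quotient_den_def)

text \<open>Each symbol with base \<open>p\<close> is \<open>p / (p - a)\<close> at
  \<open>-1\<close>. Both bases occur twice above and twice below, so the powers cancel. By
  \<open>1 / 0 = 0\<close> this stays true when some \<open>p - a\<close> vanishes.\<close>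

lemma poch_quotient_minus_one:
  "poch_quotient L b d e t r1 r2 (-1) =
    ((qpow L (2*r2) - d*e*t*exp L) * (qpow L (2*r2) - b*e*t*exp L)
      * (qpow L (2*r1) - b*d*t*exp L) * (qpow L (2*r1) - exp L/t))
    / ((qpow L (2*r1) - b*exp L) * (qpow L (2*r1) - d*exp L)
      * (qpow L (2*r2) - e*exp L) * (qpow L (2*r2) - b*d*e*t^2*exp L))"
proof -
  have factor: "qpoch a (qpow L r) (-1) = qpow L r / (qpow L r - a)" for a r
    unfolding qpoch_minus_one by (simp add: field_simps)
  have cancel: "(A/n1 * (A/n2) * (B/n3 * (B/n4))) / (B/m1 * (B/m2) * (A/m3 * (A/m4)))
      = (m1 * m2 * m3 * m4) / (n1 * n2 * n3 * n4)"
    if "A \<noteq> 0" "B \<noteq> 0" for A B n1 n2 n3 n4 m1 m2 m3 m4 :: complex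
    using that by (simp add: divide_simps)
  show ?thesis
    unfolding poch_quotient_def poch_quotient_num_def poch_quotient_den_def qpochs_pair factor
    by (rule cancel) simp_all
qed

text \<open>The two summands at \<open>k\<close> add up to
  \<open>f k * g (k + 1) - f (k - 1) * g k\<close>, which telescopes.\<close>

lemma abel_summation:
  fixes f :: "int \<Rightarrow> 'a::comm_ring"
  shows "(\<Sum>k<n. (f (int k) - f (int k - 1)) * g (int k)) =
    f (int n - 1) * g (int n) - f (-1) * g 0 - (\<Sum>k<n. (g (int k + 1) - g (int k)) * f (int k))"
  by (induction n) (simp_all add: algebra_simps)

theorem corollary4p4:
  fixes b d e y u w q L :: complex
    and t1 t2 r1 r2 s1 s2 :: real
    and n :: nat
  assumes nonzero: "b \<noteq> 0" "d \<noteq> 0" "e \<noteq> 0" "y \<noteq> 0" "u \<noteq> 0" "w \<noteq> 0" "q \<noteq> 0"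
    and log_q: "exp L = q"
    and t_pos: "t1 > 0" "t2 > 0"
    and exponents_nonneg: "r1 \<ge> 0" "r2 \<ge> 0" "s1 \<ge> 0" "s2 \<ge> 0"
    and denoms1:
      "\<And>k. k < n \<Longrightarrow> qpochs [d*e*t1*q, b*e*t1*q] (qpow L (2*r2)) (int k) \<noteq> 0"
      "\<And>k. k < n \<Longrightarrow> qpochs [b*d*t1*q, q/t1] (qpow L (2*r1)) (int k) \<noteq> 0"
      "qpochs [d*e*t1*q, b*e*t1*q] (qpow L (2*r2)) (int n - 1) \<noteq> 0"
      "qpochs [b*d*t1*q, q/t1] (qpow L (2*r1)) (int n - 1) \<noteq> 0"
    and denoms2:
      "\<And>k. k \<le> n \<Longrightarrow> qpochs [w*u*t2*q, y*u*t2*q] (qpow L (2*s2)) (int k) \<noteq> 0"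
      "\<And>k. k \<le> n \<Longrightarrow> qpochs [y*w*t2*q, q/t2] (qpow L (2*s1)) (int k) \<noteq> 0"
    and denoms3:
      "qpow L (2*r1) - b*q \<noteq> 0"
      "qpow L (2*r1) - d*q \<noteq> 0"
      "qpow L (2*r2) - e*q \<noteq> 0"
      "qpow L (2*r2) - b*d*e*t1^2*q \<noteq> 0"
  shows
    "C0 b d t1 *
       (\<Sum>k<n.
          (1 - e*t1 * qpow L (2*(r2 - r1)*(real k - 1)))
          * (1 - b*d*e*t1 * qpow L (2*(r1 + r2)*(real k - 1) + 2))
          * qpow L (2*r1*(real k - 1) + 1)
          * ((qpochs [b*q, d*q] (qpow L (2*r1)) (int k - 1)
              * qpochs [e*q, b*d*e*t1^2*q] (qpow L (2*r2)) (int k - 1))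
             / (qpochs [d*e*t1*q, b*e*t1*q] (qpow L (2*r2)) (int k)
                * qpochs [b*d*t1*q, q/t1] (qpow L (2*r1)) (int k)))
          * ((qpochs [y*q, w*q] (qpow L (2*s1)) (int k)
              * qpochs [u*q, y*w*u*t2^2*q] (qpow L (2*s2)) (int k))
             / (qpochs [w*u*t2*q, y*u*t2*q] (qpow L (2*s2)) (int k)
                * qpochs [y*w*t2*q, q/t2] (qpow L (2*s1)) (int k))))
     = ((qpochs [b*q, d*q] (qpow L (2*r1)) (int n - 1)
         * qpochs [e*q, b*d*e*t1^2*q] (qpow L (2*r2)) (int n - 1))
        / (qpochs [d*e*t1*q, b*e*t1*q] (qpow L (2*r2)) (int n - 1)
           * qpochs [b*d*t1*q, q/t1] (qpow L (2*r1)) (int n - 1)))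
       * ((qpochs [y*q, w*q] (qpow L (2*s1)) (int n)
           * qpochs [u*q, y*w*u*t2^2*q] (qpow L (2*s2)) (int n))
          / (qpochs [w*u*t2*q, y*u*t2*q] (qpow L (2*s2)) (int n)
             * qpochs [y*w*t2*q, q/t2] (qpow L (2*s1)) (int n)))
     - ((qpow L (2*r2) - d*e*t1*q) * (qpow L (2*r2) - b*e*t1*q)
        * (qpow L (2*r1) - b*d*t1*q) * (qpow L (2*r1) - q/t1))
       / ((qpow L (2*r1) - b*q) * (qpow L (2*r1) - d*q)
          * (qpow L (2*r2) - e*q) * (qpow L (2*r2) - b*d*e*t1^2*q))
     - D0 y w t2 *
       (\<Sum>k<n.
          (1 - u*t2 * qpow L (2*(s2 - s1)*real k))
          * (1 - y*w*u*t2 * qpow L (2*(s1 + s2)*real k + 2))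
          * qpow L (2*s1*real k + 1)
          * ((qpochs [y*q, w*q] (qpow L (2*s1)) (int k)
              * qpochs [u*q, y*w*u*t2^2*q] (qpow L (2*s2)) (int k))
             / (qpochs [w*u*t2*q, y*u*t2*q] (qpow L (2*s2)) (int k + 1)
                * qpochs [y*w*t2*q, q/t2] (qpow L (2*s1)) (int k + 1)))
          * ((qpochs [b*q, d*q] (qpow L (2*r1)) (int k)
              * qpochs [e*q, b*d*e*t1^2*q] (qpow L (2*r2)) (int k))
             / (qpochs [d*e*t1*q, b*e*t1*q] (qpow L (2*r2)) (int k)
                * qpochs [b*d*t1*q, q/t1] (qpow L (2*r1)) (int k))))"
proof -
  let ?R = "poch_quotient L b d e t1 r1 r2" and ?S = "poch_quotient L y w u t2 s1 s2"
  let ?A = "\<lambda>k. (1 - e*t1 * qpow L (2*(r2 - r1)*(real k - 1)))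
      * (1 - b*d*e*t1 * qpow L (2*(r1 + r2)*(real k - 1) + 2))
      * qpow L (2*r1*(real k - 1) + 1)
      * (poch_quotient_num L b d e t1 r1 r2 (int k - 1) / poch_quotient_den L b d e t1 r1 r2 (int k))"
  let ?B = "\<lambda>k. (1 - u*t2 * qpow L (2*(s2 - s1)*real k))
      * (1 - y*w*u*t2 * qpow L (2*(s1 + s2)*real k + 2))
      * qpow L (2*s1*real k + 1)
      * (poch_quotient_num L y w u t2 s1 s2 (int k) / poch_quotient_den L y w u t2 s1 s2 (int k + 1))"
  \<comment> \<open>The index is \<open>m = k - 1\<close>, so \<open>k = 0\<close> is the
    exceptional case \<open>m = -1\<close>, covered by \<open>denoms3\<close>.\<close>
  have R: "?R (int k) - ?R (int k - 1) = C0 b d t1 * ?A k" if "k < n" for k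
    using poch_quotient_diff[of t1 "int k - 1" L b d e r1 r2] that t_pos denoms1(1,2)[of k] denoms3
    by (simp add: poch_quotient_den_def log_q)
  \<comment> \<open>Here \<open>m = k\<close>, and the denominator at \<open>k + 1 \<le> n\<close>
    is covered by \<open>denoms2\<close>, whose range includes \<open>n\<close>.\<close>
  have S: "?S (int k + 1) - ?S (int k) = D0 y w t2 * ?B k" if "k < n" for k
    using poch_quotient_diff[of t2 "int k" L y w u s1 s2] that t_pos denoms2[of "Suc k"]
    by (simp add: poch_quotient_den_def log_q D0_def C0_def add.commute)
  have sum_R: "(\<Sum>k<n. (?R (int k) - ?R (int k - 1)) * ?S (int k)) = C0 b d t1 * (\<Sum>k<n. ?A k * ?S (int k))"
    unfolding sum_distrib_left by (rule sum.cong) (simp_all only: lessThan_iff R mult.assoc)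
  have sum_S: "(\<Sum>k<n. (?S (int k + 1) - ?S (int k)) * ?R (int k)) = D0 y w t2 * (\<Sum>k<n. ?B k * ?R (int k))"
    unfolding sum_distrib_left by (rule sum.cong) (simp_all only: lessThan_iff S mult.assoc)
  show ?thesis
    using abel_summation[of ?R ?S n]
    unfolding sum_R sum_S poch_quotient_minus_one poch_quotient_0 mult_1_right
    unfolding poch_quotient_def poch_quotient_num_def poch_quotient_den_def log_q .
qed

end
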